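(* Let $\mathcal X=(\Omega,S)$ be a quasi-thin scheme and $\alpha\in\Omega$. Then every fiber of the one point extension $\mathcal X_\alpha=(\Omega,S_\alpha)$ is of the form $\alpha u$ for some $u\in S$. In particular, $S_\alpha=\bigcup_{u,v\in S}S_\alpha(u,v)$, where $S_\alpha(u,v)=\{a\in S_\alpha: a\subseteq \alpha u\times\alpha v\}$.
   Context: A coherent configuration is a pair $(\Omega,S)$ with $\Omega$ finite and $S$ a partition of $\Omega\times\Omega$ (basic relations) such that $1_\Omega$ is a union of elements of $S$, $S$ is closed under transposition, and for $u,v,w\in S$ the number $|\alpha u\cap\gamma v^*|$ (with $\alpha r=\{\beta:(\alpha,\beta)\in r\}$) is independent of $(\alpha,\gamma)\in w$; it is a scheme if $1_\Omega\in S$. A fiber is a set $\Delta$ with $1_\Delta=\{(\delta,\delta):\delta\in\Delta\}\in S$. A scheme is quasi-thin if each basic relation $u$ has valency $|\alpha u|\in\{1,2\}$. For $\alpha\in\Omega$, the one point extension $\mathcal X_\alpha=(\Omega,S_\alpha)$ is the smallest coherent configuration on $\Omega$ (with respect to the order in which one configuration is below another if each relation of the first is a union of basic relations of the second) such that $\{(\alpha,\alpha)\}\in S_\alpha$ and every element of $S$ is a union of elements of $S_\alpha$. *)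

theory Defs
  imports Main "HOL-Library.Disjoint_Sets"
begin

text \<open>
  A configuration is given by its point set \<open>\<Omega>\<close> and its set \<open>S\<close> of basic relations.  For a
  relation \<open>r\<close> and a point \<open>\<alpha>\<close>, the set \<open>\<alpha> r\<close> of the literature is \<open>r `` {\<alpha>}\<close>, and \<open>1_\<Omega>\<close> is
  \<open>Id_on \<Omega>\<close>.
\<close>

definition coherent_configuration :: "'a set \<Rightarrow> ('a \<times> 'a) set set \<Rightarrow> bool" where
  "coherent_configuration \<Omega> S \<longleftrightarrow>
     finite \<Omega> \<and>
     partition_on (\<Omega> \<times> \<Omega>) S \<and>
     (\<exists>D\<subseteq>S. Id_on \<Omega> = \<Union>D) \<and>
     (\<forall>s\<in>S. s\<inverse> \<in> S) \<and>
     (\<forall>u\<in>S. \<forall>v\<in>S. \<forall>w\<in>S. \<forall>\<alpha> \<gamma> \<alpha>' \<gamma>'. (\<alpha>, \<gamma>) \<in> w \<longrightarrow> (\<alpha>', \<gamma>') \<in> w \<longrightarrow>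
        card (u `` {\<alpha>} \<inter> v\<inverse> `` {\<gamma>}) = card (u `` {\<alpha>'} \<inter> v\<inverse> `` {\<gamma>'}))"

definition scheme :: "'a set \<Rightarrow> ('a \<times> 'a) set set \<Rightarrow> bool" where
  "scheme \<Omega> S \<longleftrightarrow> coherent_configuration \<Omega> S \<and> Id_on \<Omega> \<in> S"

definition quasi_thin_scheme :: "'a set \<Rightarrow> ('a \<times> 'a) set set \<Rightarrow> bool" where
  "quasi_thin_scheme \<Omega> S \<longleftrightarrow> scheme \<Omega> S \<and> (\<forall>u\<in>S. \<forall>\<alpha>\<in>\<Omega>. card (u `` {\<alpha>}) \<in> {1, 2})"

definition fiber :: "('a \<times> 'a) set set \<Rightarrow> 'a set \<Rightarrow> bool" where
  "fiber S \<Delta> \<longleftrightarrow> Id_on \<Delta> \<in> S"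

text \<open>The order on configurations over a common point set; \<open>S\<close> is the lower (coarser) one.\<close>

definition config_le :: "('a \<times> 'a) set set \<Rightarrow> ('a \<times> 'a) set set \<Rightarrow> bool" where
  "config_le S T \<longleftrightarrow> (\<forall>s\<in>S. \<exists>U\<subseteq>T. s = \<Union>U)"

definition point_extensions :: "'a set \<Rightarrow> ('a \<times> 'a) set set \<Rightarrow> 'a \<Rightarrow> ('a \<times> 'a) set set set" where
  "point_extensions \<Omega> S \<alpha> =
     {T. coherent_configuration \<Omega> T \<and> {(\<alpha>, \<alpha>)} \<in> T \<and> config_le S T}"

text \<open>
  The basic relations of the one point extension.  The lemma \<open>one_point_extension_smallest\<close> below
  shows that the description is proper.
\<close>

definition one_point_extension :: "'a set \<Rightarrow> ('a \<times> 'a) set set \<Rightarrow> 'a \<Rightarrow> ('a \<times> 'a) set set" where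
  "one_point_extension \<Omega> S \<alpha> =
     (THE T. T \<in> point_extensions \<Omega> S \<alpha> \<and> (\<forall>T' \<in> point_extensions \<Omega> S \<alpha>. config_le T T'))"

definition extension_block ::
    "'a set \<Rightarrow> ('a \<times> 'a) set set \<Rightarrow> 'a \<Rightarrow> ('a \<times> 'a) set \<Rightarrow> ('a \<times> 'a) set \<Rightarrow> ('a \<times> 'a) set set" where
  "extension_block \<Omega> S \<alpha> u v = {a \<in> one_point_extension \<Omega> S \<alpha>. a \<subseteq> u `` {\<alpha>} \<times> v `` {\<alpha>}}"


lemma union_of_parts_iff:
  assumes "partition_on X T" "R \<subseteq> X"
  shows "(\<exists>U\<subseteq>T. R = \<Union>U) \<longleftrightarrow> (\<forall>t\<in>T. t \<subseteq> R \<or> t \<inter> R = {})"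
proof
  assume "\<exists>U\<subseteq>T. R = \<Union>U"
  then obtain U where U: "U \<subseteq> T" "R = \<Union>U" by auto
  show "\<forall>t\<in>T. t \<subseteq> R \<or> t \<inter> R = {}"
  proof
    fix t assume t: "t \<in> T"
    show "t \<subseteq> R \<or> t \<inter> R = {}"
    proof (cases "t \<in> U")
      case False
      have "t \<inter> x = {}" if "x \<in> U" for x
      proof -
        have "x \<in> T" "t \<noteq> x" using that U(1) False by auto
        then show ?thesis using disjointD[OF partition_onD2[OF assms(1)] t] by simp
      qed
      then show ?thesis using U(2) by (intro disjI2) auto
    qed (use U(2) in auto)
  qed
next
  assume sat: "\<forall>t\<in>T. t \<subseteq> R \<or> t \<inter> R = {}"
  have "R = \<Union>{t\<in>T. t \<subseteq> R}"
  proof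
    show "R \<subseteq> \<Union>{t\<in>T. t \<subseteq> R}"
    proof
      fix p assume p: "p \<in> R"
      then have "p \<in> \<Union>T" using partition_onD1[OF assms(1)] assms(2) by auto
      then obtain t where t: "t \<in> T" "p \<in> t" by auto
      then have "t \<subseteq> R" using bspec[OF sat t(1)] p by auto
      then show "p \<in> \<Union>{t\<in>T. t \<subseteq> R}" using t by auto
    qed
  qed auto
  then show "\<exists>U\<subseteq>T. R = \<Union>U" by (intro exI[of _ "{t\<in>T. t \<subseteq> R}"]) auto
qed

lemma config_le_antisym:
  assumes T: "partition_on X T" and T': "partition_on X T'"
    and le: "config_le T T'" "config_le T' T"
  shows "T = T'"
proof -
  have sub: "P \<subseteq> Q" if P: "partition_on X P" and Q: "partition_on X Q"
    and PQ: "config_le P Q" and QP: "config_le Q P" for P Q :: "('a \<times> 'a) set set"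
  proof
    fix p assume p: "p \<in> P"
    have union: "\<exists>U\<subseteq>B. a = \<Union>U" if "config_le A B" "a \<in> A" for A B :: "('a \<times> 'a) set set" and a
      using that unfolding config_le_def by simp
    obtain U where U: "U \<subseteq> Q" "p = \<Union>U" using union[OF PQ p] by auto
    have ne: "p \<noteq> {}" using P p unfolding partition_on_def by auto
    then obtain q where q: "q \<in> U" using U(2) by auto
    then have qQ: "q \<in> Q" using U(1) by auto
    obtain V where V: "V \<subseteq> P" "q = \<Union>V" using union[OF QP qQ] by auto
    have "q \<noteq> {}" using Q qQ unfolding partition_on_def by auto
    then obtain p' where p': "p' \<in> V" using V(2) by auto
    then have p'P: "p' \<in> P" using V(1) by auto
    have qp: "q \<subseteq> p" using U(2) q by auto
    have p'q: "p' \<subseteq> q" using V(2) p' by auto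
    have "p' \<noteq> {}" using P p'P unfolding partition_on_def by auto
    moreover have "p' = p \<or> p' \<inter> p = {}"
      using disjointD[OF partition_onD2[OF P] p'P p] by auto
    ultimately have "p' = p" using qp p'q by auto
    then show "p \<in> Q" using qp p'q qQ by auto
  qed
  show ?thesis using sub[OF T T' le] sub[OF T' T le(2,1)] by (rule equalityI)
qed

lemma coherent_configurationD:
  assumes "coherent_configuration \<Omega> S"
  shows "finite \<Omega>" "partition_on (\<Omega> \<times> \<Omega>) S" "\<exists>D\<subseteq>S. Id_on \<Omega> = \<Union>D" "s \<in> S \<Longrightarrow> s\<inverse> \<in> S"
proof -
  note cc = assms[unfolded coherent_configuration_def]
  show "finite \<Omega>" by (rule conjunct1[OF cc])
  note cc = conjunct2[OF cc]
  show "partition_on (\<Omega> \<times> \<Omega>) S" by (rule conjunct1[OF cc])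
  note cc = conjunct2[OF cc]
  show "\<exists>D\<subseteq>S. Id_on \<Omega> = \<Union>D" by (rule conjunct1[OF cc])
  note cc = conjunct2[OF cc]
  show "s \<in> S \<Longrightarrow> s\<inverse> \<in> S" by (rule bspec[OF conjunct1[OF cc]])
qed

lemma coherent_configuration_card:
  assumes "coherent_configuration \<Omega> S" "u \<in> S" "v \<in> S" "w \<in> S" "(\<alpha>, \<gamma>) \<in> w" "(\<alpha>', \<gamma>') \<in> w"
  shows "card (u `` {\<alpha>} \<inter> v\<inverse> `` {\<gamma>}) = card (u `` {\<alpha>'} \<inter> v\<inverse> `` {\<gamma>'})"
proof -
  have "\<forall>u\<in>S. \<forall>v\<in>S. \<forall>w\<in>S. \<forall>\<alpha> \<gamma> \<alpha>' \<gamma>'. (\<alpha>, \<gamma>) \<in> w \<longrightarrow> (\<alpha>', \<gamma>') \<in> w \<longrightarrow>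
      card (u `` {\<alpha>} \<inter> v\<inverse> `` {\<gamma>}) = card (u `` {\<alpha>'} \<inter> v\<inverse> `` {\<gamma>'})"
    using assms(1) unfolding coherent_configuration_def by (elim conjE)
  from this[rule_format, OF assms(2-)] show ?thesis .
qed

lemma card_relation_union:
  assumes fin: "finite \<Omega>" and T: "partition_on (\<Omega> \<times> \<Omega>) T" and UV: "U \<subseteq> T" "V \<subseteq> T"
  shows "card ((\<Union>U) `` {a} \<inter> (\<Union>V)\<inverse> `` {c}) =
    (\<Sum>(x, y)\<in>U \<times> V. card (x `` {a} \<inter> y\<inverse> `` {c}))"
proof -
  have finT: "finite T"
    using T fin by (metis finite_UnionD finite_SigmaI partition_onD1)
  have finUV: "finite (U \<times> V)"
    using finT UV finite_subset by blast
  have "(\<Union>U) `` {a} \<inter> (\<Union>V)\<inverse> `` {c} = (\<Union>p\<in>U \<times> V. fst p `` {a} \<inter> (snd p)\<inverse> `` {c})"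
    by auto
  moreover have "card (\<Union>p\<in>U \<times> V. fst p `` {a} \<inter> (snd p)\<inverse> `` {c}) =
      (\<Sum>p\<in>U \<times> V. card (fst p `` {a} \<inter> (snd p)\<inverse> `` {c}))"
  proof (rule card_UN_disjoint[OF finUV])
    show "\<forall>p\<in>U \<times> V. finite (fst p `` {a} \<inter> (snd p)\<inverse> `` {c})"
    proof
      fix p assume "p \<in> U \<times> V"
      then have "fst p \<subseteq> \<Omega> \<times> \<Omega>" using T UV unfolding partition_on_def by (cases p) auto
      then have "fst p `` {a} \<inter> (snd p)\<inverse> `` {c} \<subseteq> \<Omega>" by blast
      then show "finite (fst p `` {a} \<inter> (snd p)\<inverse> `` {c})" using fin finite_subset by blast
    qed
    show "\<forall>p\<in>U \<times> V. \<forall>q\<in>U \<times> V. p \<noteq> q \<longrightarrow>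
        fst p `` {a} \<inter> (snd p)\<inverse> `` {c} \<inter> (fst q `` {a} \<inter> (snd q)\<inverse> `` {c}) = {}"
    proof (intro ballI impI)
      fix p q assume pq: "p \<in> U \<times> V" "q \<in> U \<times> V" "p \<noteq> q"
      have "fst p \<inter> fst q = {} \<or> snd p \<inter> snd q = {}"
      proof (cases "fst p = fst q")
        case True
        then have "snd p \<noteq> snd q" using pq(3) by (simp add: prod_eq_iff)
        moreover have "snd p \<in> T" "snd q \<in> T" using pq UV by auto
        ultimately show ?thesis using T unfolding partition_on_def disjoint_def by simp
      next
        case False
        moreover have "fst p \<in> T" "fst q \<in> T" using pq UV by auto
        ultimately show ?thesis using T unfolding partition_on_def disjoint_def by simp
      qed
      then show "fst p `` {a} \<inter> (snd p)\<inverse> `` {c} \<inter> (fst q `` {a} \<inter> (snd q)\<inverse> `` {c}) = {}"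
        by blast
    qed
  qed
  ultimately show ?thesis by (simp add: case_prod_beta)
qed

lemma coherent_configuration_meet:
  assumes F: "\<And>T. T \<in> F \<Longrightarrow> coherent_configuration \<Omega> T" and fin: "finite \<Omega>"
  shows "\<exists>M. coherent_configuration \<Omega> M \<and>
    (\<forall>R\<subseteq>\<Omega> \<times> \<Omega>. (\<exists>U\<subseteq>M. R = \<Union>U) \<longleftrightarrow> (\<forall>T\<in>F. \<exists>U\<subseteq>T. R = \<Union>U))"
proof -
  define B where "B = {R. R \<subseteq> \<Omega> \<times> \<Omega> \<and> (\<forall>T\<in>F. \<forall>t\<in>T. t \<subseteq> R \<or> t \<inter> R = {})}"
  define A where "A p = \<Inter>{R\<in>B. p \<in> R}" for p
  define M where "M = A ` (\<Omega> \<times> \<Omega>)"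
  have part: "partition_on (\<Omega> \<times> \<Omega>) T" if "T \<in> F" for T
    by (rule coherent_configurationD(2)[OF F[OF that]])
  have B_iff: "R \<in> B \<longleftrightarrow> R \<subseteq> \<Omega> \<times> \<Omega> \<and> (\<forall>T\<in>F. \<exists>U\<subseteq>T. R = \<Union>U)" for R
  proof (cases "R \<subseteq> \<Omega> \<times> \<Omega>")
    case True
    then show ?thesis unfolding B_def using union_of_parts_iff[OF part True] by simp
  qed (simp add: B_def)
  have B_sub: "R \<subseteq> \<Omega> \<times> \<Omega>" if "R \<in> B" for R
    using that unfolding B_def by simp
  have B_sat: "t \<subseteq> R \<or> t \<inter> R = {}" if "R \<in> B" "T \<in> F" "t \<in> T" for R T t
    using that unfolding B_def by simp
  have B_I: "R \<in> B"
    if "R \<subseteq> \<Omega> \<times> \<Omega>" "\<And>T t. T \<in> F \<Longrightarrow> t \<in> T \<Longrightarrow> t \<subseteq> R \<or> t \<inter> R = {}" for R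
    using that unfolding B_def by simp
  have B_top: "\<Omega> \<times> \<Omega> \<in> B"
  proof (rule B_I)
    show "t \<subseteq> \<Omega> \<times> \<Omega> \<or> t \<inter> \<Omega> \<times> \<Omega> = {}" if "T \<in> F" "t \<in> T" for T t
      using partition_onD1[OF part[OF that(1)]] that(2) by (intro disjI1) auto
  qed simp
  have B_diff: "R - R' \<in> B" if R: "R \<in> B" and R': "R' \<in> B" for R R'
  proof (rule B_I)
    show "R - R' \<subseteq> \<Omega> \<times> \<Omega>" using B_sub[OF R] by blast
    show "t \<subseteq> R - R' \<or> t \<inter> (R - R') = {}" if "T \<in> F" "t \<in> T" for T t
      using B_sat[OF R that] B_sat[OF R' that] by blast
  qed
  have A_in: "p \<in> A p" for p unfolding A_def by simp
  have A_least: "A p \<subseteq> R" if "R \<in> B" "p \<in> R" for p R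
    using that unfolding A_def by (intro Inter_lower) simp
  have A_B: "A p \<in> B" if p: "p \<in> \<Omega> \<times> \<Omega>" for p
  proof (rule B_I)
    show "A p \<subseteq> \<Omega> \<times> \<Omega>" by (rule A_least[OF B_top p])
    fix T t assume t: "T \<in> F" "t \<in> T"
    show "t \<subseteq> A p \<or> t \<inter> A p = {}"
    proof (cases "\<forall>R\<in>B. p \<in> R \<longrightarrow> t \<subseteq> R")
      case True
      then show ?thesis unfolding A_def by (intro disjI1 Inter_greatest) simp
    next
      case False
      then obtain R where R: "R \<in> B" "p \<in> R" "\<not> t \<subseteq> R" by auto
      then have "t \<inter> R = {}" using B_sat[OF R(1) t] by simp
      then show ?thesis using A_least[OF R(1,2)] by auto
    qed
  qed
  have A_eq: "A q = A p" if p: "p \<in> \<Omega> \<times> \<Omega>" and q: "q \<in> A p" for p q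
  proof -
    have q': "q \<in> \<Omega> \<times> \<Omega>" using B_sub[OF A_B[OF p]] q by (rule subsetD)
    have "p \<in> A q"
    proof (rule ccontr)
      assume "p \<notin> A q"
      then have "p \<in> A p - A q" using A_in by simp
      then have "A p \<subseteq> A p - A q" by (rule A_least[OF B_diff[OF A_B[OF p] A_B[OF q']]])
      then have "q \<in> A p - A q" using q by (rule subsetD)
      then show False using A_in[of q] by simp
    qed
    then have "A p \<subseteq> A q" by (rule A_least[OF A_B[OF q']])
    then show ?thesis using A_least[OF A_B[OF p] q] by (intro equalityI)
  qed
  have M_B: "u \<in> B" if "u \<in> M" for u using that A_B unfolding M_def by auto
  have M_part: "partition_on (\<Omega> \<times> \<Omega>) M"
  proof (rule partition_onI)
    show "\<Union>M = \<Omega> \<times> \<Omega>"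
    proof
      show "\<Union>M \<subseteq> \<Omega> \<times> \<Omega>" using M_B B_sub by (intro Union_least) simp
      show "\<Omega> \<times> \<Omega> \<subseteq> \<Union>M"
      proof
        fix p assume "p \<in> \<Omega> \<times> \<Omega>"
        then have "A p \<in> M" unfolding M_def by (rule imageI)
        then show "p \<in> \<Union>M" using A_in by (rule UnionI)
      qed
    qed
    show "disjnt m n" if mn: "m \<in> M" "n \<in> M" "m \<noteq> n" for m n
    proof -
      obtain p q where pq: "p \<in> \<Omega> \<times> \<Omega>" "q \<in> \<Omega> \<times> \<Omega>" "m = A p" "n = A q"
        using mn unfolding M_def by auto
      have "m = n" if "r \<in> m" "r \<in> n" for r
        using A_eq[OF pq(1), of r] A_eq[OF pq(2), of r] that pq(3,4) by simp
      then show ?thesis using mn(3) unfolding disjnt_iff by auto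
    qed
    show "{} \<notin> M" using A_in unfolding M_def by auto
  qed
  have M_iff: "(\<exists>U\<subseteq>M. R = \<Union>U) \<longleftrightarrow> R \<in> B" if R: "R \<subseteq> \<Omega> \<times> \<Omega>" for R
  proof
    assume "\<exists>U\<subseteq>M. R = \<Union>U"
    then obtain U where U: "U \<subseteq> M" "R = \<Union>U" by auto
    show "R \<in> B"
    proof (rule B_I[OF R])
      fix T t assume t: "T \<in> F" "t \<in> T"
      have sat: "t \<subseteq> u \<or> t \<inter> u = {}" if "u \<in> U" for u
        using B_sat[OF M_B[of u] t] U(1) that by auto
      show "t \<subseteq> R \<or> t \<inter> R = {}"
      proof (cases "\<exists>u\<in>U. t \<subseteq> u")
        case True
        then show ?thesis using U(2) by auto
      next
        case False
        then have "t \<inter> u = {}" if "u \<in> U" for u using sat[OF that] that by auto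
        then show ?thesis using U(2) by auto
      qed
    qed
  next
    assume RB: "R \<in> B"
    have "R = \<Union>(A ` R)"
    proof
      show "R \<subseteq> \<Union>(A ` R)" using A_in by (intro subsetI UN_I)
      show "\<Union>(A ` R) \<subseteq> R" using A_least[OF RB] by (intro UN_least)
    qed
    moreover have "A ` R \<subseteq> M" unfolding M_def using R by (rule image_mono)
    ultimately show "\<exists>U\<subseteq>M. R = \<Union>U" by (intro exI[of _ "A ` R"] conjI)
  qed
  have B_conv: "R\<inverse> \<in> B" if R: "R \<in> B" for R
  proof (rule B_I)
    show "R\<inverse> \<subseteq> \<Omega> \<times> \<Omega>" using B_sub[OF R] by auto
    fix T t assume t: "T \<in> F" "t \<in> T"
    have "t\<inverse> \<in> T" by (rule coherent_configurationD(4)[OF F[OF t(1)] t(2)])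
    then have "t\<inverse> \<subseteq> R \<or> t\<inverse> \<inter> R = {}" by (rule B_sat[OF R t(1)])
    then show "t \<subseteq> R\<inverse> \<or> t \<inter> R\<inverse> = {}" by auto
  qed
  have A_conv: "A (y, x) = (A (x, y))\<inverse>" if "x \<in> \<Omega>" "y \<in> \<Omega>" for x y
  proof -
    have le: "A (d, c) \<subseteq> (A (c, d))\<inverse>" if "c \<in> \<Omega>" "d \<in> \<Omega>" for c d
    proof (rule A_least)
      show "(A (c, d))\<inverse> \<in> B" using that by (intro B_conv A_B) simp
      show "(d, c) \<in> (A (c, d))\<inverse>" using A_in by simp
    qed
    have "(A (x, y))\<inverse> \<subseteq> A (y, x)" using le[OF that(2,1)] unfolding converse_subset_swap .
    with le[OF that] show ?thesis by (rule equalityI)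
  qed
  have M_conv: "s\<inverse> \<in> M" if s: "s \<in> M" for s
  proof -
    obtain x y where xy: "x \<in> \<Omega>" "y \<in> \<Omega>" "s = A (x, y)" using s unfolding M_def by auto
    have "s\<inverse> = A (y, x)" unfolding xy(3) by (rule A_conv[OF xy(1,2), symmetric])
    then show ?thesis using xy unfolding M_def by simp
  qed
  have M_id: "\<exists>D\<subseteq>M. Id_on \<Omega> = \<Union>D"
  proof -
    have sub: "Id_on \<Omega> \<subseteq> \<Omega> \<times> \<Omega>" by auto
    have "Id_on \<Omega> \<in> B"
      unfolding B_iff
    proof (intro conjI ballI)
      show "\<exists>U\<subseteq>T. Id_on \<Omega> = \<Union>U" if "T \<in> F" for T
        by (rule coherent_configurationD(3)[OF F[OF that]])
    qed (rule sub)
    then show ?thesis using M_iff[OF sub] by simp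
  qed
  have M_num: "card (u `` {a} \<inter> v\<inverse> `` {c}) = card (u `` {a'} \<inter> v\<inverse> `` {c'})"
    if uvw: "u \<in> M" "v \<in> M" "w \<in> M" and ac: "(a, c) \<in> w" "(a', c') \<in> w" for u v w a c a' c'
  proof -
    define f where "f p = card (u `` {fst p} \<inter> v\<inverse> `` {snd p})" for p
    define L where "L = {p \<in> \<Omega> \<times> \<Omega>. f p = f (a, c)}"
    have LB: "L \<in> B"
    proof (rule B_I)
      show "L \<subseteq> \<Omega> \<times> \<Omega>" unfolding L_def by auto
      fix T t assume T: "T \<in> F" and t: "t \<in> T"
      have decomp: "\<exists>U\<subseteq>T. m = \<Union>U" if "m \<in> M" for m
        using M_B[OF that] T unfolding B_iff by simp
      obtain U where U: "U \<subseteq> T" "u = \<Union>U" using decomp[OF uvw(1)] by auto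
      obtain V where V: "V \<subseteq> T" "v = \<Union>V" using decomp[OF uvw(2)] by auto
      have f_sum: "f p = (\<Sum>(r, s)\<in>U \<times> V. card (r `` {fst p} \<inter> s\<inverse> `` {snd p}))" for p
        unfolding f_def U(2) V(2) by (rule card_relation_union[OF fin part[OF T] U(1) V(1)])
      have const: "f p = f q" if pq: "p \<in> t" "q \<in> t" for p q
        unfolding f_sum
      proof (rule sum.cong[OF refl])
        fix rs assume "rs \<in> U \<times> V"
        then obtain r s where rs: "rs = (r, s)" "r \<in> T" "s \<in> T" using U(1) V(1) by auto
        have "card (r `` {fst p} \<inter> s\<inverse> `` {snd p}) = card (r `` {fst q} \<inter> s\<inverse> `` {snd q})"
          using pq by (intro coherent_configuration_card[OF F[OF T] rs(2,3) t]) simp_all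
        then show "(case rs of (r, s) \<Rightarrow> card (r `` {fst p} \<inter> s\<inverse> `` {snd p})) =
            (case rs of (r, s) \<Rightarrow> card (r `` {fst q} \<inter> s\<inverse> `` {snd q}))"
          unfolding rs(1) by simp
      qed
      have t_sub: "t \<subseteq> \<Omega> \<times> \<Omega>" using partition_onD1[OF part[OF T]] t by auto
      show "t \<subseteq> L \<or> t \<inter> L = {}"
      proof (cases "\<exists>q\<in>t. f q = f (a, c)")
        case True
        then obtain q where q: "q \<in> t" "f q = f (a, c)" by auto
        have "p \<in> L" if "p \<in> t" for p
          unfolding L_def using const[OF that q(1)] q(2) subsetD[OF t_sub that] by simp
        then show ?thesis by (intro disjI1 subsetI)
      qed (auto simp: L_def)
    qed
    obtain p where p: "p \<in> \<Omega> \<times> \<Omega>" "w = A p" using uvw(3) unfolding M_def by auto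
    have w: "w = A (a, c)" using A_eq[OF p(1), of "(a, c)"] ac(1) p(2) by simp
    have "(a, c) \<in> L"
      unfolding L_def using subsetD[OF B_sub[OF M_B[OF uvw(3)]] ac(1)] by simp
    then have "w \<subseteq> L" unfolding w by (rule A_least[OF LB])
    then have "(a', c') \<in> L" using ac(2) by (rule subsetD)
    then show ?thesis unfolding L_def f_def by simp
  qed
  show ?thesis
  proof (intro exI[of _ M] conjI allI impI)
    show "coherent_configuration \<Omega> M"
      unfolding coherent_configuration_def
    proof (intro conjI)
      show "\<forall>s\<in>M. s\<inverse> \<in> M" using M_conv by (rule ballI)
      show "\<forall>u\<in>M. \<forall>v\<in>M. \<forall>w\<in>M. \<forall>\<alpha> \<gamma> \<alpha>' \<gamma>'. (\<alpha>, \<gamma>) \<in> w \<longrightarrow> (\<alpha>', \<gamma>') \<in> w \<longrightarrow>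
          card (u `` {\<alpha>} \<inter> v\<inverse> `` {\<gamma>}) = card (u `` {\<alpha>'} \<inter> v\<inverse> `` {\<gamma>'})"
      proof (intro ballI allI impI)
        fix u v w \<alpha> \<gamma> \<alpha>' \<gamma>'
        assume "u \<in> M" "v \<in> M" "w \<in> M" "(\<alpha>, \<gamma>) \<in> w" "(\<alpha>', \<gamma>') \<in> w"
        then show "card (u `` {\<alpha>} \<inter> v\<inverse> `` {\<gamma>}) = card (u `` {\<alpha>'} \<inter> v\<inverse> `` {\<gamma>'})"
          by (rule M_num)
      qed
    qed (fact fin M_part M_id)+
    show "(\<exists>U\<subseteq>M. R = \<Union>U) \<longleftrightarrow> (\<forall>T\<in>F. \<exists>U\<subseteq>T. R = \<Union>U)" if "R \<subseteq> \<Omega> \<times> \<Omega>" for R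
      unfolding M_iff[OF that] B_iff using that by simp
  qed
qed

lemma one_point_extension_smallest:
  assumes S: "coherent_configuration \<Omega> S" and \<alpha>: "\<alpha> \<in> \<Omega>"
  shows "one_point_extension \<Omega> S \<alpha> \<in> point_extensions \<Omega> S \<alpha>"
    and "\<And>T'. T' \<in> point_extensions \<Omega> S \<alpha> \<Longrightarrow> config_le (one_point_extension \<Omega> S \<alpha>) T'"
proof -
  let ?F = "point_extensions \<Omega> S \<alpha>"
  have fin: "finite \<Omega>" and Spart: "partition_on (\<Omega> \<times> \<Omega>) S"
    using coherent_configurationD[OF S] by simp_all
  have partF: "partition_on (\<Omega> \<times> \<Omega>) T" if "T \<in> ?F" for T
    using that unfolding point_extensions_def by (intro coherent_configurationD(2)) simp
  obtain M where M: "coherent_configuration \<Omega> M"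
    and M_iff: "\<And>R. R \<subseteq> \<Omega> \<times> \<Omega> \<Longrightarrow> (\<exists>U\<subseteq>M. R = \<Union>U) \<longleftrightarrow> (\<forall>T\<in>?F. \<exists>U\<subseteq>T. R = \<Union>U)"
  proof -
    have *: "coherent_configuration \<Omega> T" if "T \<in> ?F" for T
      using that unfolding point_extensions_def by simp
    from coherent_configuration_meet[of ?F, OF * fin] show ?thesis using that by auto
  qed
  have Mpart: "partition_on (\<Omega> \<times> \<Omega>) M" by (rule coherent_configurationD(2)[OF M])
  have "config_le S M"
    unfolding config_le_def
  proof
    fix s assume s: "s \<in> S"
    have "s \<subseteq> \<Omega> \<times> \<Omega>" using partition_onD1[OF Spart] s by auto
    moreover have "\<exists>U\<subseteq>T. s = \<Union>U" if "T \<in> ?F" for T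
      using that s unfolding point_extensions_def config_le_def by simp
    ultimately show "\<exists>U\<subseteq>M. s = \<Union>U" using M_iff by simp
  qed
  moreover have "{(\<alpha>, \<alpha>)} \<in> M"
  proof -
    have "\<exists>U\<subseteq>T. {(\<alpha>, \<alpha>)} = \<Union>U" if "T \<in> ?F" for T
      using that unfolding point_extensions_def by (intro exI[of _ "{{(\<alpha>, \<alpha>)}}"]) simp
    then have "\<exists>U\<subseteq>M. {(\<alpha>, \<alpha>)} = \<Union>U" using M_iff[of "{(\<alpha>, \<alpha>)}"] \<alpha> by simp
    then obtain U where U: "U \<subseteq> M" "{(\<alpha>, \<alpha>)} = \<Union>U" by auto
    have "(\<alpha>, \<alpha>) \<in> \<Union>U" unfolding U(2)[symmetric] by simp
    then obtain u where u: "u \<in> U" "(\<alpha>, \<alpha>) \<in> u" by auto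
    have "u \<subseteq> {(\<alpha>, \<alpha>)}" unfolding U(2) using u(1) by auto
    then have "u = {(\<alpha>, \<alpha>)}" using u(2) by auto
    then show ?thesis using u(1) U(1) by auto
  qed
  ultimately have M_F: "M \<in> ?F" using M unfolding point_extensions_def by simp
  have M_le: "config_le M T" if "T \<in> ?F" for T
    unfolding config_le_def
  proof
    fix m assume m: "m \<in> M"
    have "m \<subseteq> \<Omega> \<times> \<Omega>" using partition_onD1[OF Mpart] m by auto
    from M_iff[OF this] have "\<forall>T\<in>?F. \<exists>U\<subseteq>T. m = \<Union>U" using m by auto
    then show "\<exists>U\<subseteq>T. m = \<Union>U" using that by (rule bspec)
  qed
  have "one_point_extension \<Omega> S \<alpha> = M"
    unfolding one_point_extension_def
  proof (rule the_equality)
    show "M \<in> ?F \<and> (\<forall>T'\<in>?F. config_le M T')" using M_F M_le by simp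
    show "T = M" if "T \<in> ?F \<and> (\<forall>T'\<in>?F. config_le T T')" for T
      using that M_F M_le by (intro config_le_antisym[OF partF partF]) auto
  qed
  then show "one_point_extension \<Omega> S \<alpha> \<in> ?F"
    and "\<And>T'. T' \<in> ?F \<Longrightarrow> config_le (one_point_extension \<Omega> S \<alpha>) T'"
    using M_F M_le by auto
qed

end

theory Submission
  imports Defs
begin

text \<open>
  Fix \<open>\<alpha>\<close>, and let \<open>\<sigma>\<close> fix or interchange the points of each \<open>\<alpha> u\<close> according to its size.  For
  \<open>s \<in> S\<close> the bipartite graph \<open>s \<inter> (\<alpha> u \<times> \<alpha> v)\<close> is biregular by coherence, and its sides have
  at most two points, so it is empty, complete or a perfect matching; in each case it is invariant
  under \<open>\<sigma>\<close>.  Thus \<open>\<sigma>\<close> is an automorphism of the scheme fixing \<open>\<alpha>\<close>, and the orbitals of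
  \<open>{1, \<sigma>}\<close> form a coherent configuration above \<open>S_\<alpha>\<close>.  Hence no \<open>\<alpha> u\<close> splits in \<open>S_\<alpha>\<close>.
\<close>

section \<open>Orbitals of an involution\<close>

text \<open>If \<sigma> is an involution of \<Omega>, these are the orbits of the group
  \<open>{1, \<sigma>}\<close> on pairs; the doubleton collapses to a singleton at a fixed
  pair.\<close>

definition involution_orbitals :: "'a set \<Rightarrow> ('a \<Rightarrow> 'a) \<Rightarrow> ('a \<times> 'a) set set" where
  "involution_orbitals \<Omega> \<sigma> = (\<lambda>p. {p, map_prod \<sigma> \<sigma> p}) ` (\<Omega> \<times> \<Omega>)"

lemma involution_orbitals_invariant:
  assumes "\<And>x. x \<in> \<Omega> \<Longrightarrow> \<sigma> (\<sigma> x) = x" "t \<in> involution_orbitals \<Omega> \<sigma>" "(x, y) \<in> t"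
  shows "(\<sigma> x, \<sigma> y) \<in> t"
  using assms unfolding involution_orbitals_def by auto

text \<open>The orbitals of the pairs in \<open>R\<close> cover \<open>R\<close>, and invariance
  keeps them inside it. This later places the scheme below the orbital configuration.\<close>

lemma invariant_union_of_orbitals:
  assumes "R \<subseteq> \<Omega> \<times> \<Omega>" "\<And>x y. (x, y) \<in> R \<Longrightarrow> (\<sigma> x, \<sigma> y) \<in> R"
  shows "\<exists>U\<subseteq>involution_orbitals \<Omega> \<sigma>. R = \<Union>U"
proof (intro exI conjI)
  show "(\<lambda>p. {p, map_prod \<sigma> \<sigma> p}) ` R \<subseteq> involution_orbitals \<Omega> \<sigma>"
    unfolding involution_orbitals_def using assms(1) by blast
  show "R = \<Union>((\<lambda>p. {p, map_prod \<sigma> \<sigma> p}) ` R)"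
    using assms(2) by auto
qed

text \<open>Two pairs of one orbital are equal or exchanged by \<sigma>, and \<sigma> carries the
  intermediate points counted at one pair to those counted at the other.\<close>

lemma coherent_configuration_involution_orbitals:
  assumes fin: "finite \<Omega>" and closed: "\<And>x. x \<in> \<Omega> \<Longrightarrow> \<sigma> x \<in> \<Omega>"
    and inv: "\<And>x. x \<in> \<Omega> \<Longrightarrow> \<sigma> (\<sigma> x) = x"
  shows "coherent_configuration \<Omega> (involution_orbitals \<Omega> \<sigma>)" (is "coherent_configuration \<Omega> ?T")
  unfolding coherent_configuration_def
proof (intro conjI ballI allI impI)
  have sub: "t \<subseteq> \<Omega> \<times> \<Omega>" if "t \<in> ?T" for t
    using that closed unfolding involution_orbitals_def by auto
  have step: "(\<sigma> x, \<sigma> y) \<in> t" if "t \<in> ?T" "(x, y) \<in> t" for t x y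
    using involution_orbitals_invariant[OF inv that] .
  show "partition_on (\<Omega> \<times> \<Omega>) ?T"
  proof (rule partition_onI)
    show "\<Union>?T = \<Omega> \<times> \<Omega>"
      using sub unfolding involution_orbitals_def by blast
    show "disjnt p q" if pq: "p \<in> ?T" "q \<in> ?T" "p \<noteq> q" for p q
    proof -
      obtain a b c d where
        p: "a \<in> \<Omega>" "b \<in> \<Omega>" "p = {(a, b), (\<sigma> a, \<sigma> b)}" and
        q: "c \<in> \<Omega>" "d \<in> \<Omega>" "q = {(c, d), (\<sigma> c, \<sigma> d)}"
        using pq(1,2) unfolding involution_orbitals_def by auto
      \<comment> \<open>An orbital is the orbit of each of its members, so orbitals that share a
        pair coincide.\<close>
      have "p = {r, map_prod \<sigma> \<sigma> r}" if "r \<in> p" for r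
        using that p inv[OF p(1)] inv[OF p(2)] by auto
      moreover have "q = {r, map_prod \<sigma> \<sigma> r}" if "r \<in> q" for r
        using that q inv[OF q(1)] inv[OF q(2)] by auto
      ultimately show ?thesis using pq(3) unfolding disjnt_iff by metis
    qed
    show "{} \<notin> ?T" unfolding involution_orbitals_def by auto
  qed
  show "\<exists>D\<subseteq>?T. Id_on \<Omega> = \<Union>D"
    by (rule invariant_union_of_orbitals) (use closed in auto)
  show "s\<inverse> \<in> ?T" if "s \<in> ?T" for s
  proof -
    obtain x y where xy: "x \<in> \<Omega>" "y \<in> \<Omega>" "s = {(x, y), (\<sigma> x, \<sigma> y)}"
      using \<open>s \<in> ?T\<close> unfolding involution_orbitals_def by auto
    have "s\<inverse> = {(y, x), map_prod \<sigma> \<sigma> (y, x)}" unfolding xy(3) by auto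
    then show ?thesis using xy(1,2) unfolding involution_orbitals_def by blast
  qed
  fix u v w a c a' c'
  assume uvw: "u \<in> ?T" "v \<in> ?T" "w \<in> ?T" and ac: "(a, c) \<in> w" "(a', c') \<in> w"
  have le: "card (u `` {x} \<inter> v\<inverse> `` {y}) \<le> card (u `` {\<sigma> x} \<inter> v\<inverse> `` {\<sigma> y})" for x y
  proof (rule card_inj_on_le)
    show "inj_on \<sigma> (u `` {x} \<inter> v\<inverse> `` {y})"
      by (rule inj_on_inverseI[of _ \<sigma>]) (use sub[OF uvw(1)] inv in blast)
    show "\<sigma> ` (u `` {x} \<inter> v\<inverse> `` {y}) \<subseteq> u `` {\<sigma> x} \<inter> v\<inverse> `` {\<sigma> y}"
      using step[OF uvw(1)] step[OF uvw(2)] by auto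
    show "finite (u `` {\<sigma> x} \<inter> v\<inverse> `` {\<sigma> y})"
      by (rule finite_subset[OF _ fin]) (use sub[OF uvw(1)] in blast)
  qed
  \<comment> \<open>The reverse inequality is the same one at the image pair, since \<sigma> is an
    involution.\<close>
  have eq: "card (u `` {x} \<inter> v\<inverse> `` {y}) = card (u `` {\<sigma> x} \<inter> v\<inverse> `` {\<sigma> y})"
    if "x \<in> \<Omega>" "y \<in> \<Omega>" for x y
    using le[of x y] le[of "\<sigma> x" "\<sigma> y"] inv that by simp
  obtain x y where xy: "x \<in> \<Omega>" "y \<in> \<Omega>" "w = {(x, y), (\<sigma> x, \<sigma> y)}"
    using uvw(3) unfolding involution_orbitals_def by auto
  show "card (u `` {a} \<inter> v\<inverse> `` {c}) = card (u `` {a'} \<inter> v\<inverse> `` {c'})"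
    using ac eq[OF xy(1,2)] unfolding xy(3) by auto
qed (rule fin)

section \<open>Basic relations and two-step paths\<close>

lemma coherent_configuration_part:
  assumes "coherent_configuration \<Omega> S" "x \<in> \<Omega>" "y \<in> \<Omega>"
  obtains s where "s \<in> S" "(x, y) \<in> s"
  using partition_onD1[OF coherent_configurationD(2)[OF assms(1)]] assms(2,3) by blast

lemma coherent_configuration_part_unique:
  assumes "coherent_configuration \<Omega> S" "s \<in> S" "t \<in> S" "p \<in> s" "p \<in> t"
  shows "s = t"
  using disjointD[OF partition_onD2[OF coherent_configurationD(2)[OF assms(1)]] assms(2,3)]
    assms(4,5) by blast

lemma coherent_configuration_subset:
  assumes "coherent_configuration \<Omega> S" "s \<in> S"
  shows "s \<subseteq> \<Omega> \<times> \<Omega>"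
  using partition_onD1[OF coherent_configurationD(2)[OF assms(1)]] assms(2) by blast

text \<open>An intersection number that is nonzero at one pair of \<open>w\<close> is nonzero at
  every pair of \<open>w\<close>, so two-step paths can be moved along \<open>w\<close>.\<close>

lemma coherent_configuration_card_transfer:
  assumes S: "coherent_configuration \<Omega> S" and uvw: "u \<in> S" "v \<in> S" "w \<in> S"
    and w: "(a, c) \<in> w" "(a', c') \<in> w" and z: "(a, z) \<in> u" "(z, c) \<in> v"
  obtains z' where "(a', z') \<in> u" "(z', c') \<in> v"
proof -
  have "u `` {a} \<subseteq> \<Omega>" using coherent_configuration_subset[OF S uvw(1)] by blast
  \<comment> \<open>Finiteness excludes the default value 0 of \<open>card\<close> on infinite
    sets.\<close>
  then have "finite (u `` {a} \<inter> v\<inverse> `` {c})"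
    using coherent_configurationD(1)[OF S] by (meson finite_Int finite_subset)
  then have "card (u `` {a} \<inter> v\<inverse> `` {c}) \<noteq> 0" using z by auto
  then have "card (u `` {a'} \<inter> v\<inverse> `` {c'}) \<noteq> 0"
    using coherent_configuration_card[OF S uvw w] by simp
  then have "u `` {a'} \<inter> v\<inverse> `` {c'} \<noteq> {}" by force
  then show thesis using that by blast
qed

text \<open>Since \<open>{(\<alpha>, \<alpha>)}\<close> is basic, \<alpha> is distinguished in
  \<open>T\<close>: a path through \<alpha> joining one pair of \<open>a\<close> moves to a path
  through \<alpha> joining any other pair of \<open>a\<close>.\<close>

lemma point_extension_block:
  assumes S: "coherent_configuration \<Omega> S" and \<alpha>: "\<alpha> \<in> \<Omega>"
    and T: "T \<in> point_extensions \<Omega> S \<alpha>" and a: "a \<in> T"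
  obtains u v where "u \<in> S" "v \<in> S" "a \<subseteq> u `` {\<alpha>} \<times> v `` {\<alpha>}"
proof -
  have cc: "coherent_configuration \<Omega> T" and pt: "{(\<alpha>, \<alpha>)} \<in> T" and le: "config_le S T"
    using T unfolding point_extensions_def by auto
  note part = coherent_configurationD(2)[OF cc]
  have "\<exists>t\<in>T. \<exists>u\<in>S. (\<alpha>, x) \<in> t \<and> t \<subseteq> u \<and> t \<subseteq> {\<alpha>} \<times> UNIV" if x: "x \<in> \<Omega>" for x
  proof -
    obtain t where t: "t \<in> T" "(\<alpha>, x) \<in> t" by (rule coherent_configuration_part[OF cc \<alpha> x])
    obtain u where u: "u \<in> S" "(\<alpha>, x) \<in> u" by (rule coherent_configuration_part[OF S \<alpha> x])
    have "\<exists>U\<subseteq>T. u = \<Union>U" using le u(1) unfolding config_le_def by blast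
    then have "t \<subseteq> u"
      using union_of_parts_iff[OF part coherent_configuration_subset[OF S u(1)]] t u(2) by blast
    \<comment> \<open>The path \<alpha>, \<alpha>, \<open>x\<close> moves to a path from
      \<open>b\<close> whose first step lies in \<open>{(\<alpha>, \<alpha>)}\<close>.\<close>
    moreover have "b = \<alpha>" if "(b, c) \<in> t" for b c
      by (rule coherent_configuration_card_transfer[OF cc pt t(1) t(1) t(2) that _ t(2)]) simp_all
    then have "t \<subseteq> {\<alpha>} \<times> UNIV" by auto
    ultimately show ?thesis using t u(1) by metis
  qed
  note col = this
  have "a \<noteq> {}" using partition_onD3[OF part] a by blast
  then obtain x y where xy: "(x, y) \<in> a" by auto
  then have "x \<in> \<Omega>" "y \<in> \<Omega>" using coherent_configuration_subset[OF cc a] by auto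
  then obtain t t' u v where t: "t \<in> T" "(\<alpha>, x) \<in> t" "t \<subseteq> u" "t \<subseteq> {\<alpha>} \<times> UNIV"
    and t': "t' \<in> T" "(\<alpha>, y) \<in> t'" "t' \<subseteq> v" and uv: "u \<in> S" "v \<in> S"
    using col by meson
  have "(\<alpha>, x') \<in> u \<and> (\<alpha>, y') \<in> v" if xy': "(x', y') \<in> a" for x' y'
  proof -
    \<comment> \<open>The path from \<open>x\<close> to \<open>y\<close> through \<alpha> is moved
      to (\<open>x'\<close>, \<open>y'\<close>); its middle point \<open>z\<close> is again
      \<alpha>, because every pair of \<open>t\<close> starts there.\<close>
    obtain z where z: "(x', z) \<in> t\<inverse>" "(z, y') \<in> t'"
      using coherent_configuration_card_transfer[OF cc coherent_configurationD(4)[OF cc t(1)]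
          t'(1) a xy xy', of \<alpha>] t(2) t'(2) by blast
    then show ?thesis using t(3,4) t'(3) by blast
  qed
  then have "a \<subseteq> u `` {\<alpha>} \<times> v `` {\<alpha>}" by auto
  then show thesis by (rule that[OF uv])
qed

section \<open>The automorphism attached to a point\<close>

lemma quasi_thin_involution:
  assumes qt: "quasi_thin_scheme \<Omega> S" and \<alpha>: "\<alpha> \<in> \<Omega>"
  obtains \<sigma> where "\<And>x. x \<in> \<Omega> \<Longrightarrow> \<sigma> x \<in> \<Omega>" "\<And>x. x \<in> \<Omega> \<Longrightarrow> \<sigma> (\<sigma> x) = x" "\<sigma> \<alpha> = \<alpha>"
    "\<And>u x. u \<in> S \<Longrightarrow> (\<alpha>, x) \<in> u \<Longrightarrow> u `` {\<alpha>} = {x, \<sigma> x}"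
    "\<And>s x y. s \<in> S \<Longrightarrow> (x, y) \<in> s \<Longrightarrow> (\<sigma> x, \<sigma> y) \<in> s"
proof -
  have S: "coherent_configuration \<Omega> S" and diag: "Id_on \<Omega> \<in> S"
    and val: "\<And>u. u \<in> S \<Longrightarrow> card (u `` {\<alpha>}) \<in> {1, 2}"
    using qt \<alpha> unfolding quasi_thin_scheme_def scheme_def by auto
  \<comment> \<open>The partner of \<open>x\<close> is unique because only one basic relation
    contains \<open>(\<alpha>, x)\<close>; if its row at \<alpha> has one point, the partner is
    \<open>x\<close> itself.\<close>
  define \<sigma> where "\<sigma> x = (THE y. \<exists>u\<in>S. (\<alpha>, x) \<in> u \<and> u `` {\<alpha>} = {x, y})" for x
  have row: "u `` {\<alpha>} = {x, \<sigma> x}" if u: "u \<in> S" "(\<alpha>, x) \<in> u" for u x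
  proof -
    obtain y where y: "u `` {\<alpha>} = {x, y}"
    proof (cases "card (u `` {\<alpha>}) = 1")
      case True
      then obtain b where "u `` {\<alpha>} = {b}" by (rule card_1_singletonE)
      moreover have "x \<in> u `` {\<alpha>}" using u(2) by blast
      ultimately show thesis using that[of x] by simp
    next
      case False
      then have "card (u `` {\<alpha>}) = 2" using val[OF u(1)] by simp
      then obtain b c where bc: "u `` {\<alpha>} = {b, c}" by (auto simp: card_2_iff)
      moreover have "x \<in> u `` {\<alpha>}" using u(2) by blast
      ultimately have "u `` {\<alpha>} = {x, b} \<or> u `` {\<alpha>} = {x, c}" by auto
      then show thesis using that by metis
    qed
    have "\<sigma> x = y"
      unfolding \<sigma>_def
    proof (rule the_equality)
      show "\<exists>u\<in>S. (\<alpha>, x) \<in> u \<and> u `` {\<alpha>} = {x, y}" using u y by blast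
      show "y' = y" if ex: "\<exists>v\<in>S. (\<alpha>, x) \<in> v \<and> v `` {\<alpha>} = {x, y'}" for y'
      proof -
        obtain v where v: "v \<in> S" "(\<alpha>, x) \<in> v" "v `` {\<alpha>} = {x, y'}"
          using ex by blast
        then have "v = u" using coherent_configuration_part_unique[OF S v(1) u(1) v(2) u(2)] by simp
        then show ?thesis using v(3) y by (auto simp: doubleton_eq_iff)
      qed
    qed
    then show ?thesis using y by simp
  qed
  have row_of: "\<exists>u\<in>S. (\<alpha>, x) \<in> u \<and> (\<alpha>, \<sigma> x) \<in> u \<and> u `` {\<alpha>} = {x, \<sigma> x}"
    if x: "x \<in> \<Omega>" for x
  proof -
    obtain u where "u \<in> S" "(\<alpha>, x) \<in> u" by (rule coherent_configuration_part[OF S \<alpha> x])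
    then show ?thesis using row by blast
  qed
  show thesis
  proof (rule that)
    show closed: "\<sigma> x \<in> \<Omega>" if "x \<in> \<Omega>" for x
      using row_of[OF that] coherent_configuration_subset[OF S] by blast
    show "\<sigma> (\<sigma> x) = x" if x: "x \<in> \<Omega>" for x
    proof -
      obtain u where u: "u \<in> S" "(\<alpha>, \<sigma> x) \<in> u" "u `` {\<alpha>} = {x, \<sigma> x}"
        using row_of[OF x] by blast
      then show ?thesis using row[OF u(1,2)] by (auto simp: doubleton_eq_iff)
    qed
    \<comment> \<open>The diagonal is basic, and its row at \<alpha> is
      \<open>{\<alpha>}\<close>.\<close>
    show "\<sigma> \<alpha> = \<alpha>" using row[OF diag, of \<alpha>] \<alpha> by blast
    show "u `` {\<alpha>} = {x, \<sigma> x}" if "u \<in> S" "(\<alpha>, x) \<in> u" for u x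
      using row that .
    show "(\<sigma> x, \<sigma> y) \<in> s" if s: "s \<in> S" "(x, y) \<in> s" for s x y
    proof (rule ccontr)
      assume no: "(\<sigma> x, \<sigma> y) \<notin> s"
      have "x \<in> \<Omega>" "y \<in> \<Omega>" using coherent_configuration_subset[OF S s(1)] s(2) by auto
      then obtain u v where u: "u \<in> S" "(\<alpha>, x) \<in> u" "(\<alpha>, \<sigma> x) \<in> u" "u `` {\<alpha>} = {x, \<sigma> x}"
        and v: "v \<in> S" "(\<alpha>, y) \<in> v" "(\<alpha>, \<sigma> y) \<in> v" "v `` {\<alpha>} = {y, \<sigma> y}"
        using row_of by meson
      \<comment> \<open>As \<open>x\<close> and \<open>\<sigma> x\<close> lie in the same row, the
        path \<open>x\<close>, \<open>y\<close>, \<alpha> moves to one from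
        \<open>\<sigma> x\<close>. Its middle point is \<open>y\<close> or
        \<open>\<sigma> y\<close>, and the assumption leaves only \<open>y\<close>.\<close>
      obtain z where z: "(\<sigma> x, z) \<in> s" "(z, \<alpha>) \<in> v\<inverse>"
        using coherent_configuration_card_transfer[OF S s(1) coherent_configurationD(4)[OF S v(1)]
            coherent_configurationD(4)[OF S u(1)], of x \<alpha> "\<sigma> x" \<alpha> y] u(2,3) v(2) s(2) by blast
      have "z \<in> {y, \<sigma> y}" using z(2) unfolding v(4)[symmetric] by simp
      then have xy: "(\<sigma> x, y) \<in> s" using z(1) no by auto
      \<comment> \<open>Now \<open>y\<close> is joined by \<open>s\<close> to both \<open>x\<close>
        and \<open>\<sigma> x\<close>, while \<open>\<sigma> y\<close> is not joined to
        \<open>\<sigma> x\<close>. Coherence demands equal counts, because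
        \<open>(\<alpha>, y)\<close> and \<open>(\<alpha>, \<sigma> y)\<close> both lie in
        \<open>v\<close>.\<close>
      have "card (u `` {\<alpha>} \<inter> s\<inverse> `` {\<sigma> y}) < card (u `` {\<alpha>} \<inter> s\<inverse> `` {y})"
        by (rule psubset_card_mono) (use u(4) s(2) no xy in auto)
      then show False
        using coherent_configuration_card[OF S u(1) s(1) v(1) v(2,3)] by simp
    qed
  qed
qed

section \<open>Fibers and blocks of the one point extension\<close>

theorem theorem6p1:
  fixes \<Omega> :: "'a set" and S :: "('a \<times> 'a) set set" and \<alpha> :: 'a
  assumes "quasi_thin_scheme \<Omega> S" and "\<alpha> \<in> \<Omega>"
  shows "(\<forall>\<Delta>. fiber (one_point_extension \<Omega> S \<alpha>) \<Delta> \<longrightarrow> (\<exists>u\<in>S. \<Delta> = u `` {\<alpha>})) \<and>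
    one_point_extension \<Omega> S \<alpha> = (\<Union>u\<in>S. \<Union>v\<in>S. extension_block \<Omega> S \<alpha> u v)"
proof (intro conjI allI impI)
  let ?E = "one_point_extension \<Omega> S \<alpha>"
  have S: "coherent_configuration \<Omega> S"
    using assms(1) unfolding quasi_thin_scheme_def scheme_def by simp
  have E: "?E \<in> point_extensions \<Omega> S \<alpha>"
    by (rule one_point_extension_smallest(1)[OF S assms(2)])
  then have ccE: "coherent_configuration \<Omega> ?E" unfolding point_extensions_def by simp
  show "?E = (\<Union>u\<in>S. \<Union>v\<in>S. extension_block \<Omega> S \<alpha> u v)"
  proof
    show "?E \<subseteq> (\<Union>u\<in>S. \<Union>v\<in>S. extension_block \<Omega> S \<alpha> u v)"
    proof
      fix a assume a: "a \<in> ?E"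
      obtain u v where "u \<in> S" "v \<in> S" "a \<subseteq> u `` {\<alpha>} \<times> v `` {\<alpha>}"
        by (rule point_extension_block[OF S assms(2) E a])
      then show "a \<in> (\<Union>u\<in>S. \<Union>v\<in>S. extension_block \<Omega> S \<alpha> u v)"
        using a unfolding extension_block_def by blast
    qed
  qed (auto simp: extension_block_def)
  fix \<Delta> assume "fiber ?E \<Delta>"
  then have \<Delta>: "Id_on \<Delta> \<in> ?E" unfolding fiber_def .
  obtain \<sigma> where \<sigma>: "\<And>x. x \<in> \<Omega> \<Longrightarrow> \<sigma> x \<in> \<Omega>" "\<And>x. x \<in> \<Omega> \<Longrightarrow> \<sigma> (\<sigma> x) = x" "\<sigma> \<alpha> = \<alpha>"
    and row: "\<And>u x. u \<in> S \<Longrightarrow> (\<alpha>, x) \<in> u \<Longrightarrow> u `` {\<alpha>} = {x, \<sigma> x}"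
    and aut: "\<And>s x y. s \<in> S \<Longrightarrow> (x, y) \<in> s \<Longrightarrow> (\<sigma> x, \<sigma> y) \<in> s"
    using quasi_thin_involution[OF assms] by blast
  let ?T = "involution_orbitals \<Omega> \<sigma>"
  have "coherent_configuration \<Omega> ?T"
    by (rule coherent_configuration_involution_orbitals[OF coherent_configurationD(1)[OF S] \<sigma>(1,2)])
  moreover have "{(\<alpha>, \<alpha>)} \<in> ?T"
    unfolding involution_orbitals_def
    by (rule image_eqI[of _ _ "(\<alpha>, \<alpha>)"]) (use assms(2) \<sigma>(3) in simp_all)
  moreover have "config_le S ?T"
    unfolding config_le_def
  proof
    show "\<exists>U\<subseteq>?T. s = \<Union>U" if "s \<in> S" for s
      by (rule invariant_union_of_orbitals[OF coherent_configuration_subset[OF S that] aut[OF that]])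
  qed
  \<comment> \<open>The orbitals are one of the configurations over which the extension is minimal,
    so each of its basic relations is \<sigma>-invariant.\<close>
  ultimately have "config_le ?E ?T"
    using one_point_extension_smallest(2)[OF S assms(2)] unfolding point_extensions_def by blast
  then obtain U where U: "U \<subseteq> ?T" "Id_on \<Delta> = \<Union>U"
    using \<Delta> unfolding config_le_def by blast
  have closed: "\<sigma> x \<in> \<Delta>" if "x \<in> \<Delta>" for x
  proof -
    have "(x, x) \<in> \<Union>U" using that U(2) by blast
    then have "(\<sigma> x, \<sigma> x) \<in> \<Union>U"
      using involution_orbitals_invariant[OF \<sigma>(2)] U(1) by blast
    then show ?thesis using U(2) by blast
  qed
  have "Id_on \<Delta> \<noteq> {}"
    using partition_onD3[OF coherent_configurationD(2)[OF ccE]] \<Delta> by metis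
  then obtain x where x: "x \<in> \<Delta>" by auto
  \<comment> \<open>The block bounds \<Delta> above by a single row at \<alpha>. That row is
    \<open>{x, \<sigma> x}\<close>, and the invariant set \<Delta> contains both points.\<close>
  obtain u v where u: "u \<in> S" "Id_on \<Delta> \<subseteq> u `` {\<alpha>} \<times> v `` {\<alpha>}"
    by (rule point_extension_block[OF S assms(2) E \<Delta>])
  then have sub: "\<Delta> \<subseteq> u `` {\<alpha>}" by blast
  have "u `` {\<alpha>} = {x, \<sigma> x}" using row[OF u(1)] sub x by blast
  then have "\<Delta> = u `` {\<alpha>}" using sub x closed[OF x] by auto
  then show "\<exists>u\<in>S. \<Delta> = u `` {\<alpha>}" using u(1) by (rule bexI)
qed

end
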